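(* Let $0\le k<n<N$ be integers and let $A$ be an $n\times N$ random matrix with an orthant-symmetric and generic random nullspace. Then $$\frac{\mathcal{E}f_k(A\mathbb{R}_+^N)}{f_k(\mathbb{R}_+^N)}=1-P_{N-n,N-k},$$ where, for positive integers $m,M$, $$P_{m,M}=2^{-M+1}\sum_{\ell=0}^{m-1}\binom{M-1}{\ell}.$$
   Context: $\mathbb{R}_+^N=\{x\in\mathbb{R}^N: x_i\ge 0\ \forall i\}$. For a polyhedron $Q$, $f_k(Q)$ denotes the number of $k$-dimensional faces of $Q$; $AQ$ is the image of $Q$ under $A$; $\mathcal{E}$ denotes expectation. A random $(N-n)\times N$ matrix $B$ is orthant-symmetric if for each diagonal matrix $S$ with diagonal in $\{-1,1\}^N$ and every measurable set $\Omega$, $\mathrm{Prob}\{BS\in\Omega\}=\mathrm{Prob}\{B\in\Omega\}$. Let $V_B$ be the linear span of the rows of $B$. If $B$ is orthant-symmetric, $V_B$ is called an orthant-symmetric random subspace. If every subset of $N-n$ columns of $B$ is almost surely linearly independent, $V_B$ is called a generic random subspace. A random $n\times N$ matrix $A$ has an orthant-symmetric and generic nullspace if its nullspace $\mathcal{N}(A)$ equals $V_B$ for a random matrix $B$ having both properties. *)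

theory Defs
  imports "HOL-Probability.Probability"
begin

text \<open>Only faces of dimension at least 0 are counted: the empty face has affine dimension -1.
  A polyhedron has finitely many faces, so the cardinality is meaningful for polyhedra.\<close>

definition face_count :: "nat \<Rightarrow> 'a::euclidean_space set \<Rightarrow> nat" where
  "face_count k Q = card {F. F face_of Q \<and> aff_dim F = int k}"

definition nonneg_orthant :: "(real ^ 'N) set" where
  "nonneg_orthant = {x. \<forall>i. 0 \<le> x $ i}"

definition nullspace :: "real ^ 'N ^ 'n \<Rightarrow> (real ^ 'N) set" where
  "nullspace A = {x. A *v x = 0}"

definition row_space :: "real ^ 'N ^ 'm \<Rightarrow> (real ^ 'N) set" where
  "row_space B = span (rows B)"

definition sign_matrix :: "real ^ 'N ^ 'N \<Rightarrow> bool" where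
  "sign_matrix S \<longleftrightarrow>
     (\<forall>i j. i \<noteq> j \<longrightarrow> S $ i $ j = 0) \<and> (\<forall>i. S $ i $ i \<in> {-1, 1})"

definition orthant_symmetric :: "'w measure \<Rightarrow> ('w \<Rightarrow> real ^ 'N ^ 'm) \<Rightarrow> bool" where
  "orthant_symmetric M B \<longleftrightarrow>
     (\<forall>S \<Omega>. sign_matrix S \<longrightarrow> \<Omega> \<in> sets borel \<longrightarrow>
        \<P>(\<omega> in M. B \<omega> ** S \<in> \<Omega>) = \<P>(\<omega> in M. B \<omega> \<in> \<Omega>))"

text \<open>Linear independence refers to the family of columns indexed by \<open>J\<close>, so repeated
  columns have to be excluded by injectivity.\<close>

definition generic_columns :: "'w measure \<Rightarrow> ('w \<Rightarrow> real ^ 'N ^ 'm) \<Rightarrow> bool" where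
  "generic_columns M B \<longleftrightarrow>
     (\<forall>J :: 'N set. card J = CARD('m) \<longrightarrow>
        (AE \<omega> in M. inj_on (\<lambda>j. column j (B \<omega>)) J \<and>
                    independent ((\<lambda>j. column j (B \<omega>)) ` J)))"

text \<open>The matrix \<open>B\<close> lives on the same probability space as \<open>A\<close>, and the equality of the two
  random subspaces is required almost surely.\<close>

definition orthant_symmetric_generic_nullspace ::
    "'w measure \<Rightarrow> ('w \<Rightarrow> real ^ 'N ^ 'n) \<Rightarrow> ('w \<Rightarrow> real ^ 'N ^ 'm) \<Rightarrow> bool" where
  "orthant_symmetric_generic_nullspace M A B \<longleftrightarrow>
     CARD('m) = CARD('N) - CARD('n) \<and>
     B \<in> borel_measurable M \<and> orthant_symmetric M B \<and> generic_columns M B \<and>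
     (AE \<omega> in M. nullspace (A \<omega>) = row_space (B \<omega>))"

definition wendel_P :: "nat \<Rightarrow> nat \<Rightarrow> real" where
  "wendel_P m K = 2 powi (1 - int K) * (\<Sum>l = 0..m - 1. real ((K - 1) choose l))"

end

theory Submission
  imports Defs
begin

text \<open>For every matrix \<open>A\<close>, the faces of \<open>A \<real>\<^sub>+\<^sup>N\<close> are the images of those coordinate faces of the
  orthant, indexed by sets \<open>J\<close>, for which no \<open>v\<close> in the nullspace of \<open>A\<close> is nonnegative and not
  identically zero outside \<open>J\<close>. For a nullspace \<open>V\<close> in general position and \<open>k < n\<close>, the face \<open>J\<close> with
  \<open>card J = k\<close> is lost iff \<open>V\<close> contains a vector that is positive on all of \<open>-J\<close>. A deletion
  recursion shows that \<open>V\<close>, of dimension \<open>m\<close>, realises exactly \<open>2 (\<Sum>l<m. (K - 1) choose l)\<close> of the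
  \<open>2 ^ K\<close> sign patterns on a set of \<open>K\<close> coordinates (Schlaefli, Wendel). By orthant symmetry all
  patterns are equally likely, so the face is lost with probability \<open>P\<^bsub>m,K\<^esub>\<close> where \<open>K = N - k\<close>. As the
  integral is only meaningful for measurable integrands, the face count must also be shown to be a
  Borel function of \<open>A\<close>, degenerate matrices included.\<close>

subsection \<open>Sign patterns of a subspace in general position\<close>

text \<open>Interpolation on few coordinates and uniqueness on many replace \<open>dim V = d\<close>, so that cutting
  with a coordinate hyperplane lowers \<open>d\<close> by one without any dimension count.\<close>

definition general_position :: "nat \<Rightarrow> 'N set \<Rightarrow> (real ^ 'N) set \<Rightarrow> bool" where
  "general_position d I V \<longleftrightarrow> subspace V \<and>
     (\<forall>T c. T \<subseteq> I \<and> card T \<le> d \<longrightarrow> (\<exists>v\<in>V. \<forall>i\<in>T. v $ i = c i)) \<and>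
     (\<forall>T v. T \<subseteq> I \<and> d \<le> card T \<and> v \<in> V \<and> (\<forall>i\<in>T. v $ i = 0) \<longrightarrow> v = 0)"

text \<open>A strict pattern is recorded by its set of positive coordinates, so these sets index the
  regions into which the hyperplanes \<open>v $ i = 0\<close> with \<open>i \<in> I\<close> cut
  \<open>V\<close>.\<close>

definition sign_patterns :: "'N set \<Rightarrow> (real ^ 'N) set \<Rightarrow> 'N set set" where
  "sign_patterns I V =
     {P. P \<subseteq> I \<and> (\<exists>v\<in>V. (\<forall>i\<in>P. 0 < v $ i) \<and> (\<forall>i\<in>I - P. v $ i < 0))}"

lemma general_positionI:
  assumes "subspace V"
    and "\<And>T c. T \<subseteq> I \<Longrightarrow> card T \<le> d \<Longrightarrow> \<exists>v\<in>V. \<forall>i\<in>T. v $ i = c i"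
    and "\<And>T v. T \<subseteq> I \<Longrightarrow> d \<le> card T \<Longrightarrow> v \<in> V \<Longrightarrow> (\<And>i. i \<in> T \<Longrightarrow> v $ i = 0) \<Longrightarrow> v = 0"
  shows "general_position d I V"
  using assms unfolding general_position_def by blast

lemma general_position_subspace: "general_position d I V \<Longrightarrow> subspace V"
  by (simp add: general_position_def)

lemma general_position_interpolate:
  assumes "general_position d I V" "T \<subseteq> I" "card T \<le> d"
  obtains v where "v \<in> V" "\<And>i. i \<in> T \<Longrightarrow> v $ i = c i"
  using assms unfolding general_position_def by meson

lemma general_position_eq_0:
  assumes "general_position d I V" "T \<subseteq> I" "d \<le> card T" "v \<in> V" "\<And>i. i \<in> T \<Longrightarrow> v $ i = 0"
  shows "v = 0"
  using assms unfolding general_position_def by blast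

lemma general_position_mono:
  "general_position d I V \<Longrightarrow> J \<subseteq> I \<Longrightarrow> general_position d J V"
  unfolding general_position_def by (meson order_trans)

text \<open>Both clauses for a set \<open>T\<close> in the section come from those for
  \<open>insert j T\<close> in \<open>V\<close>, with value 0 at \<open>j\<close>.\<close>

lemma general_position_hyperplane:
  fixes I :: "'N::finite set"
  assumes gp: "general_position (Suc d) (insert j I) V" and j: "j \<notin> I"
  shows "general_position d I {v \<in> V. v $ j = 0}"
proof (rule general_positionI)
  show "subspace {v \<in> V. v $ j = 0}"
    using general_position_subspace[OF gp] by (auto simp: subspace_def)
next
  fix T :: "'N set" and c :: "'N \<Rightarrow> real"
  assume T: "T \<subseteq> I" "card T \<le> d"
  then have "insert j T \<subseteq> insert j I" "card (insert j T) \<le> Suc d" "j \<notin> T"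
    using j by (auto simp: card_insert_if)
  from general_position_interpolate[OF gp this(1,2), of "c(j := 0)"]
  obtain v where "v \<in> V" and v: "\<And>i. i \<in> insert j T \<Longrightarrow> v $ i = (c(j := 0)) i"
    by blast
  moreover have "v $ j = 0" using v[of j] by simp
  moreover have "v $ i = c i" if "i \<in> T" for i
    using v[of i] that \<open>j \<notin> T\<close> by auto
  ultimately show "\<exists>v\<in>{v \<in> V. v $ j = 0}. \<forall>i\<in>T. v $ i = c i"
    by blast
next
  fix T and v :: "real ^ 'N"
  assume T: "T \<subseteq> I" "d \<le> card T" and v: "v \<in> {v \<in> V. v $ j = 0}" "\<And>i. i \<in> T \<Longrightarrow> v $ i = 0"
  have "j \<notin> T" using T j by auto
  then have "Suc d \<le> card (insert j T)"
    using T by (simp add: card_insert_if)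
  moreover have "insert j T \<subseteq> insert j I" using T by auto
  ultimately show "v = 0"
    by (intro general_position_eq_0[OF gp, of "insert j T" v]) (use v in auto)
qed

lemma small_perturbation:
  fixes f g :: "'a \<Rightarrow> real"
  assumes "finite I" "\<And>i. i \<in> I \<Longrightarrow> 0 < f i"
  obtains e where "0 < e" "\<And>i. i \<in> I \<Longrightarrow> 0 < f i + e * g i"
proof -
  have "\<forall>\<^sub>F e in at_right 0. 0 < f i + e * g i" if "i \<in> I" for i
  proof -
    have "((\<lambda>e. f i + e * g i) \<longlongrightarrow> f i + 0 * g i) (at_right 0)"
      by (intro tendsto_intros)
    then show ?thesis
      using assms(2)[OF that] by (auto intro: order_tendstoD)
  qed
  then have "\<forall>\<^sub>F e in at_right 0. \<forall>i\<in>I. 0 < f i + e * g i"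
    using assms(1) by (simp add: eventually_ball_finite)
  moreover have "\<forall>\<^sub>F e::real in at_right 0. 0 < e"
    by (simp add: eventually_at_right_less)
  ultimately have "\<forall>\<^sub>F e in at_right 0. 0 < e \<and> (\<forall>i\<in>I. 0 < f i + e * g i)"
    by eventually_elim auto
  then have "\<exists>e>0. \<forall>i\<in>I. 0 < f i + e * g i"
    by (metis (mono_tags, lifting) eventually_happens' trivial_limit_at_right_real)
  then show ?thesis using that by blast
qed

text \<open>A pattern on \<open>I\<close> extends to \<open>insert j I\<close> in both ways iff it is realised on the
  hyperplane where coordinate \<open>j\<close> vanishes.\<close>

lemma card_sign_patterns_insert:
  fixes I :: "'N::finite set"
  assumes gp: "general_position (Suc d) (insert j I) V" and j: "j \<notin> I"
  shows "card (sign_patterns (insert j I) V)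
       = card (sign_patterns I V) + card (sign_patterns I {v \<in> V. v $ j = 0})"
proof -
  have sub: "subspace V" by (rule general_position_subspace[OF gp])
  define A where "A = {P. P \<subseteq> I \<and> insert j P \<in> sign_patterns (insert j I) V}"
  define B where "B = {P. P \<subseteq> I \<and> P \<in> sign_patterns (insert j I) V}"
  \<comment> \<open>Interpolation at the single index \<open>j\<close> yields a direction in
    \<open>V\<close> that changes coordinate \<open>j\<close>.\<close>
  obtain w where w: "w \<in> V" "w $ j = 1"
    using general_position_interpolate[OF gp, of "{j}" "\<lambda>_. 1"] by auto
  \<comment> \<open>A small multiple of \<open>w\<close> gives coordinate \<open>j\<close> the sign
    \<open>s\<close> and keeps the signs on \<open>I\<close>. If the starting vector vanishes at
    \<open>j\<close>, both signs can be reached.\<close>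
  have push: "\<exists>u\<in>V. s * u $ j > 0 \<and> (\<forall>i\<in>P. 0 < u $ i) \<and> (\<forall>i\<in>I - P. u $ i < 0)"
    if P: "P \<subseteq> I" "v \<in> V" "\<forall>i\<in>P. 0 < v $ i" "\<forall>i\<in>I - P. v $ i < 0" "s * v $ j \<ge> 0" "\<bar>s\<bar> = 1"
    for P v and s :: real
  proof -
    obtain e where e: "0 < e" "\<And>i. i \<in> I \<Longrightarrow> 0 < \<bar>v $ i\<bar> + e * (- \<bar>w $ i\<bar>)"
    proof (rule small_perturbation[of I "\<lambda>i. \<bar>v $ i\<bar>" "\<lambda>i. - \<bar>w $ i\<bar>"])
      show "0 < \<bar>v $ i\<bar>" if "i \<in> I" for i
        using P that by (cases "i \<in> P") force+
    qed auto
    let ?u = "v + (e * s) *\<^sub>R w"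
    have small: "\<bar>e * s * w $ i\<bar> < \<bar>v $ i\<bar>" if "i \<in> I" for i
      using e(2)[OF that] e(1) P(6) by (simp add: abs_mult)
    have "?u \<in> V" using sub P w by (simp add: subspace_add subspace_scale)
    moreover have "s * ?u $ j > 0"
    proof -
      have "s * s = 1" using P(6) by (metis abs_mult_self_eq mult_1)
      then have "s * ?u $ j = s * v $ j + e"
        using w(2) by (simp add: algebra_simps)
      then show ?thesis using P(5) e(1) by linarith
    qed
    moreover have "\<forall>i\<in>P. 0 < ?u $ i" "\<forall>i\<in>I - P. ?u $ i < 0"
      using small P by (auto, smt (verit) subsetD, smt (verit) DiffI)
    ultimately show ?thesis by blast
  qed
  have pos: "P \<in> A \<longleftrightarrow> P \<subseteq> I \<and> (\<exists>v\<in>V. v $ j > 0 \<and> (\<forall>i\<in>P. 0 < v $ i) \<and> (\<forall>i\<in>I - P. v $ i < 0))" for P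
  proof -
    have "P \<subseteq> I \<Longrightarrow> insert j I - insert j P = I - P" using j by auto
    then show ?thesis unfolding A_def sign_patterns_def by auto
  qed
  have neg: "P \<in> B \<longleftrightarrow> P \<subseteq> I \<and> (\<exists>v\<in>V. v $ j < 0 \<and> (\<forall>i\<in>P. 0 < v $ i) \<and> (\<forall>i\<in>I - P. v $ i < 0))" for P
  proof -
    have "P \<subseteq> I \<Longrightarrow> insert j I - P = insert j (I - P)" using j by auto
    then show ?thesis unfolding B_def sign_patterns_def by auto
  qed
  have "sign_patterns (insert j I) V = insert j ` A \<union> B"
  proof (intro equalityI subsetI)
    fix Q assume Q: "Q \<in> sign_patterns (insert j I) V"
    then have "Q \<subseteq> insert j I" by (simp add: sign_patterns_def)
    show "Q \<in> insert j ` A \<union> B"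
    proof (cases "j \<in> Q")
      case True
      then have "Q = insert j (Q - {j})" "Q - {j} \<in> A"
        using Q \<open>Q \<subseteq> insert j I\<close> by (auto simp: A_def insert_absorb)
      then show ?thesis by blast
    next
      case False
      then show ?thesis using Q \<open>Q \<subseteq> insert j I\<close> by (auto simp: B_def)
    qed
  qed (auto simp: A_def B_def)
  moreover have "insert j ` A \<inter> B = {}" using j by (auto simp: A_def B_def)
  moreover have "inj_on (insert j) A"
    using j by (intro inj_onI) (auto simp: A_def; blast)
  ultimately have "card (sign_patterns (insert j I) V) = card A + card B"
    by (simp add: card_Un_disjoint card_image)
  \<comment> \<open>The union collects the patterns on \<open>I\<close> that extend in at least one
    way, the intersection those that extend in both ways.\<close>
  also have "\<dots> = card (A \<union> B) + card (A \<inter> B)"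
    by (rule card_Un_Int) simp_all
  also have "A \<union> B = sign_patterns I V"
  proof (intro equalityI subsetI)
    fix P assume "P \<in> A \<union> B"
    then show "P \<in> sign_patterns I V" using pos neg by (auto simp: sign_patterns_def)
  next
    fix P assume "P \<in> sign_patterns I V"
    then obtain v where v: "P \<subseteq> I" "v \<in> V" "\<forall>i\<in>P. 0 < v $ i" "\<forall>i\<in>I - P. v $ i < 0"
      by (auto simp: sign_patterns_def)
    show "P \<in> A \<union> B"
    proof (cases "v $ j \<ge> 0")
      case True
      then show ?thesis using push[OF v, of 1] v pos by auto
    next
      case False
      then show ?thesis using v neg[of P] by (auto simp: not_le)
    qed
  qed
  also have "A \<inter> B = sign_patterns I {v \<in> V. v $ j = 0}"
  proof (intro equalityI subsetI)
    fix P assume "P \<in> A \<inter> B"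
    then obtain u v where P: "P \<subseteq> I"
      and u: "u \<in> V" "u $ j > 0" "\<forall>i\<in>P. 0 < u $ i" "\<forall>i\<in>I - P. u $ i < 0"
      and v: "v \<in> V" "v $ j < 0" "\<forall>i\<in>P. 0 < v $ i" "\<forall>i\<in>I - P. v $ i < 0"
      using pos[of P] neg[of P] by auto
    \<comment> \<open>The weights \<open>u $ j\<close> and \<open>- v $ j\<close> are positive and
      cancel coordinate \<open>j\<close>, so the common strict signs of \<open>u\<close> and
      \<open>v\<close> on \<open>I\<close> are kept.\<close>
    let ?z = "(u $ j) *\<^sub>R v + (- v $ j) *\<^sub>R u"
    have "?z \<in> V" using sub u v by (meson subspace_add subspace_scale)
    moreover have "?z $ j = 0" by simp
    moreover have "\<forall>i\<in>P. 0 < ?z $ i"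
    proof
      fix i assume "i \<in> P"
      then have "u $ j * v $ i > 0" "v $ j * u $ i < 0"
        using u v by (simp_all add: mult_neg_pos)
      then show "0 < ?z $ i" by simp
    qed
    moreover have "\<forall>i\<in>I - P. ?z $ i < 0"
    proof
      fix i assume "i \<in> I - P"
      then have "u $ j * v $ i < 0" "v $ j * u $ i > 0"
        using u v by (simp_all add: mult_pos_neg mult_neg_neg)
      then show "?z $ i < 0" by simp
    qed
    ultimately show "P \<in> sign_patterns I {v \<in> V. v $ j = 0}"
      using P by (auto simp: sign_patterns_def)
  next
    fix P assume "P \<in> sign_patterns I {v \<in> V. v $ j = 0}"
    then obtain v where v: "P \<subseteq> I" "v \<in> V" "\<forall>i\<in>P. 0 < v $ i" "\<forall>i\<in>I - P. v $ i < 0"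
      and "v $ j = 0"
      by (auto simp: sign_patterns_def)
    then show "P \<in> A \<inter> B"
      using push[OF v, of 1] push[OF v, of "-1"] pos[of P] neg[of P] by auto
  qed
  finally show ?thesis .
qed

text \<open>Deletion and restriction give c(K+1, d+1) = c(K, d+1) + c(K, d) for the counts, which is
  Pascal's rule for partial binomial sums. The induction generalises \<open>d\<close> and
  \<open>V\<close> because the hyperplane section changes both.\<close>

lemma card_sign_patterns:
  fixes I :: "'N::finite set"
  assumes "I \<noteq> {}" and "general_position d I V"
  shows "card (sign_patterns I V) = 2 * (\<Sum>l<d. (card I - 1) choose l)"
proof -
  have "finite I" by simp
  then show ?thesis using assms
  proof (induction I arbitrary: d V rule: finite_ne_induct)
    case (singleton j)
    show ?case
    proof (cases d)
      case 0
      then have "v = 0" if "v \<in> V" for v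
        using general_position_eq_0[OF singleton, of "{}" v] that by auto
      then have "sign_patterns {j} V = {}"
        by (fastforce simp: sign_patterns_def)
      then show ?thesis using 0 by simp
    next
      case (Suc d')
      \<comment> \<open>On no coordinates there is exactly one pattern, the empty one, so both
        summands of the recursion are 1.\<close>
      have "sign_patterns {} W = {{}}" if "subspace W" for W :: "(real^'N) set"
        using subspace_0[OF that] by (auto simp: sign_patterns_def)
      then have "card (sign_patterns {j} V) = 2"
        using card_sign_patterns_insert[of d' j "{}" V] singleton Suc
          general_position_subspace[OF general_position_hyperplane[of d' j "{}" V]]
          general_position_subspace[OF singleton]
        by simp
      moreover have "(\<Sum>l<d. 0 choose l) = (1::nat)"
        unfolding Suc lessThan_Suc_eq_insert_0 by (simp add: sum.reindex)
      ultimately show ?thesis by simp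
    qed
  next
    case (insert j I)
    show ?case
    proof (cases d)
      case 0
      then have "v = 0" if "v \<in> V" for v
        using general_position_eq_0[OF insert.prems, of "{}" v] that by auto
      then have "sign_patterns (insert j I) V = {}"
        by (fastforce simp: sign_patterns_def)
      then show ?thesis using 0 by simp
    next
      case (Suc d')
      have "general_position (Suc d') I V"
        using insert.prems general_position_mono unfolding Suc by blast
      note IH = insert.IH[OF this]
        insert.IH[OF general_position_hyperplane[OF insert.prems[unfolded Suc] insert.hyps(3)]]
      \<comment> \<open>\<open>I\<close> is nonempty here, so the truncated
        \<open>card I - 1\<close> is a true predecessor.\<close>
      obtain K where K: "card I = Suc K"
        using insert.hyps by (metis card_gt_0_iff gr0_implies_Suc)
      have pascal: "(\<Sum>l<Suc d'. Suc K choose l) = (\<Sum>l<Suc d'. K choose l) + (\<Sum>l<d'. K choose l)"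
        unfolding lessThan_Suc_eq_insert_0 by (simp add: sum.reindex sum.distrib)
      show ?thesis
        using card_sign_patterns_insert[OF insert.prems[unfolded Suc] insert.hyps(3)] IH
          insert.hyps(3) K pascal
        unfolding Suc by simp
    qed
  qed
qed

subsection \<open>Faces of the image of the orthant\<close>

definition orthant_face :: "'N set \<Rightarrow> (real ^ 'N) set" where
  "orthant_face J = {x. (\<forall>i. 0 \<le> x $ i) \<and> (\<forall>i. i \<notin> J \<longrightarrow> x $ i = 0)}"

text \<open>Vectors of the nullspace that are nonnegative off \<open>J\<close> are the directions in
  which a relative interior point of \<open>orthant_face J\<close> can move a little within the
  orthant without changing its image. Survival says that no such motion leaves the span of the
  face.\<close>

definition face_survives :: "real ^ 'N ^ 'n \<Rightarrow> 'N set \<Rightarrow> bool" where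
  "face_survives A J \<longleftrightarrow>
     (\<forall>v \<in> nullspace A. (\<forall>i. i \<notin> J \<longrightarrow> 0 \<le> v $ i) \<longrightarrow> (\<forall>i. i \<notin> J \<longrightarrow> v $ i = 0))"

lemma convex_orthant_face: "convex (orthant_face J)"
  by (auto simp: convex_alt orthant_face_def)

lemma orthant_face_subset: "orthant_face J \<subseteq> nonneg_orthant"
  by (auto simp: orthant_face_def nonneg_orthant_def)

lemma zero_in_orthant_face: "0 \<in> orthant_face J"
  by (simp add: orthant_face_def)

lemma convex_nonneg_orthant: "convex (nonneg_orthant :: (real ^ 'N) set)"
  by (auto simp: convex_alt nonneg_orthant_def)

text \<open>Positive coordinates absorb a small step in any direction, so only the vanishing ones
  constrain \<open>y\<close>.\<close>

lemma nonneg_orthant_perturbation: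
  fixes x y :: "real ^ 'N::finite"
  assumes "x \<in> nonneg_orthant" and "\<And>i. x $ i = 0 \<Longrightarrow> 0 \<le> y $ i"
  obtains e where "0 < e" "x + e *\<^sub>R y \<in> nonneg_orthant"
proof -
  obtain e where e: "0 < e" "\<And>i. i \<in> {i. 0 < x $ i} \<Longrightarrow> 0 < x $ i + e * y $ i"
    by (rule small_perturbation[of "{i. 0 < x $ i}" "\<lambda>i. x $ i" "\<lambda>i. y $ i"]) auto
  have "0 \<le> x $ i + e * y $ i" for i
  proof (cases "x $ i = 0")
    case True then show ?thesis using assms(2) e(1) by simp
  next
    case False
    then have "0 < x $ i" using assms(1) by (simp add: nonneg_orthant_def less_le)
    then show ?thesis using e(2)[of i] by simp
  qed
  then show ?thesis using that[OF e(1)] by (simp add: nonneg_orthant_def)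
qed

text \<open>If \<open>A *v z\<close> is a proper convex combination of \<open>A *v x\<close> and
  \<open>A *v y\<close>, the same combination of \<open>x\<close> and \<open>y\<close> minus
  \<open>z\<close> lies in the nullspace and is nonnegative off \<open>J\<close>. Survival makes it
  vanish there, and as \<open>x\<close> and \<open>y\<close> have no negative entries, both vanish
  off \<open>J\<close>.\<close>

lemma face_of_image_orthant_face:
  fixes A :: "real ^ 'N::finite ^ 'n::finite"
  assumes "face_survives A J"
  shows "((*v) A ` orthant_face J) face_of ((*v) A ` nonneg_orthant)"
  unfolding face_of_def
proof (intro conjI ballI impI)
  show "(*v) A ` orthant_face J \<subseteq> (*v) A ` nonneg_orthant"
    using orthant_face_subset by (rule image_mono)
  show "convex ((*v) A ` orthant_face J)"
    by (intro convex_linear_image convex_orthant_face matrix_vector_mul_linear)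
  have *: "x \<in> orthant_face J"
    if "x \<in> nonneg_orthant" "y \<in> nonneg_orthant" "z \<in> orthant_face J" "0 \<le> t" "t < 1"
      "A *v z = (1 - t) *\<^sub>R (A *v x) + t *\<^sub>R (A *v y)" for x y z t
  proof -
    let ?v = "(1 - t) *\<^sub>R x + t *\<^sub>R y - z"
    have "?v \<in> nullspace A"
      using that(6) unfolding nullspace_def
      by (simp add: matrix_vector_mult_diff_distrib matrix_vector_right_distrib matrix_vector_mult_scaleR)
    moreover have "0 \<le> ?v $ i" if "i \<notin> J" for i
      using that \<open>x \<in> _\<close> \<open>y \<in> _\<close> \<open>z \<in> _\<close> \<open>0 \<le> t\<close> \<open>t < 1\<close>
      by (simp add: orthant_face_def nonneg_orthant_def)
    ultimately have v0: "?v $ i = 0" if "i \<notin> J" for i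
      using that assms unfolding face_survives_def by blast
    have "x $ i = 0" if "i \<notin> J" for i
    proof -
      have "(1 - t) * x $ i + t * y $ i = 0"
        using v0[OF that] \<open>z \<in> _\<close> that by (simp add: orthant_face_def)
      moreover have "0 \<le> (1 - t) * x $ i" "0 \<le> t * y $ i"
        using \<open>x \<in> _\<close> \<open>y \<in> _\<close> \<open>0 \<le> t\<close> \<open>t < 1\<close> by (simp_all add: nonneg_orthant_def)
      ultimately have "(1 - t) * x $ i = 0" by linarith
      then show ?thesis using \<open>t < 1\<close> by simp
    qed
    then show ?thesis using that(1) by (simp add: orthant_face_def nonneg_orthant_def)
  qed
  fix a b c
  assume "a \<in> (*v) A ` nonneg_orthant" "b \<in> (*v) A ` nonneg_orthant"
    "c \<in> (*v) A ` orthant_face J" "c \<in> open_segment a b"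
  then obtain x y z t where "a = A *v x" "b = A *v y" "c = A *v z"
    and xyz: "x \<in> nonneg_orthant" "y \<in> nonneg_orthant" "z \<in> orthant_face J" "0 < t" "t < 1"
      "A *v z = (1 - t) *\<^sub>R (A *v x) + t *\<^sub>R (A *v y)"
    by (auto simp: in_segment)
  moreover have "x \<in> orthant_face J"
    by (rule *[of x y z t]) (use xyz in auto)
  moreover have "y \<in> orthant_face J"
    by (rule *[of y x z "1 - t"]) (use xyz in \<open>auto simp: add.commute\<close>)
  ultimately show "a \<in> (*v) A ` orthant_face J" "b \<in> (*v) A ` orthant_face J"
    by auto
qed

text \<open>The index set of a face is the support of a point of maximal support in its preimage.\<close>

lemma face_of_image_orthant_cases:
  fixes A :: "real ^ 'N::finite ^ 'n::finite"
  assumes F: "F face_of ((*v) A ` nonneg_orthant)" and "F \<noteq> {}"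
  obtains J where "face_survives A J" "F = (*v) A ` orthant_face J"
proof -
  define G where "G = {x \<in> nonneg_orthant. A *v x \<in> F}"
  have "F \<subseteq> (*v) A ` nonneg_orthant" by (rule face_of_imp_subset[OF F])
  then have FG: "F = (*v) A ` G" by (auto simp: G_def)
  have "convex F" by (rule face_of_imp_convex[OF F])
  define supp where "supp = (\<lambda>x :: real ^ 'N. {i. x $ i \<noteq> 0})"
  obtain x where x: "x \<in> G" and xmax: "\<And>y. y \<in> G \<Longrightarrow> card (supp y) \<le> card (supp x)"
  proof -
    have "finite ((\<lambda>x. card (supp x)) ` G)"
      by (rule finite_subset[of _ "{..CARD('N)}"]) (auto simp: card_mono)
    moreover have "(\<lambda>x. card (supp x)) ` G \<noteq> {}" using FG \<open>F \<noteq> {}\<close> by auto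
    ultimately have "Max ((\<lambda>x. card (supp x)) ` G) \<in> (\<lambda>x. card (supp x)) ` G" by (rule Max_in)
    then obtain x where "x \<in> G" "Max ((\<lambda>x. card (supp x)) ` G) = card (supp x)" by auto
    then show ?thesis using that[of x] \<open>finite ((\<lambda>x. card (supp x)) ` G)\<close>
      by (metis Max_ge imageI)
  qed
  have x0: "x \<in> nonneg_orthant" and AxF: "A *v x \<in> F" using x by (auto simp: G_def)
  have supp_le: "supp y \<subseteq> supp x" if y: "y \<in> G" for y
  proof -
    \<comment> \<open>Nonnegative entries cannot cancel, so the support of the midpoint is the union
      of both supports; maximality of \<open>supp x\<close> then absorbs
      \<open>supp y\<close>.\<close>
    let ?z = "(1/2) *\<^sub>R x + (1/2) *\<^sub>R y"
    have "A *v ?z = (1/2) *\<^sub>R (A *v x) + (1/2) *\<^sub>R (A *v y)"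
      by (simp add: matrix_vector_right_distrib matrix_vector_mult_scaleR)
    moreover have "\<dots> \<in> F"
      by (rule convexD[OF \<open>convex F\<close> AxF]) (use y in \<open>auto simp: G_def\<close>)
    moreover have "?z \<in> nonneg_orthant"
      by (rule convexD[OF convex_nonneg_orthant x0]) (use y in \<open>auto simp: G_def\<close>)
    ultimately have "?z \<in> G" by (simp add: G_def)
    have "?z $ i \<noteq> 0" if "x $ i \<noteq> 0 \<or> y $ i \<noteq> 0" for i
    proof -
      have "0 \<le> x $ i" "0 \<le> y $ i"
        using x0 y by (auto simp: G_def nonneg_orthant_def)
      then have "0 < x $ i + y $ i" using that by linarith
      then show ?thesis by simp
    qed
    then have "supp x \<union> supp y \<subseteq> supp ?z"
      unfolding supp_def by blast
    then have "card (supp x \<union> supp y) \<le> card (supp ?z)"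
      by (intro card_mono) simp_all
    also have "\<dots> \<le> card (supp x)" by (rule xmax[OF \<open>?z \<in> G\<close>])
    finally have "supp x = supp x \<union> supp y"
      by (intro card_seteq) simp_all
    then show ?thesis by blast
  qed
  have "face_survives A (supp x)"
    unfolding face_survives_def
  proof (intro ballI impI allI)
    fix v i assume v: "v \<in> nullspace A" "\<forall>i. i \<notin> supp x \<longrightarrow> 0 \<le> v $ i" and i: "i \<notin> supp x"
    \<comment> \<open>Moving \<open>x\<close> along \<open>v\<close> keeps its image, hence stays in
      \<open>G\<close>, whose members vanish outside \<open>supp x\<close>.\<close>
    obtain e where e: "0 < e" "x + e *\<^sub>R v \<in> nonneg_orthant"
      by (rule nonneg_orthant_perturbation[OF x0, of v]) (use v in \<open>auto simp: supp_def\<close>)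
    have "A *v (x + e *\<^sub>R v) = A *v x"
      using v(1) by (simp add: nullspace_def matrix_vector_right_distrib matrix_vector_mult_scaleR)
    then have "x + e *\<^sub>R v \<in> G" using e AxF by (simp add: G_def)
    then have "i \<notin> supp (x + e *\<^sub>R v)" using supp_le i by blast
    then show "v $ i = 0" using i e(1) by (simp add: supp_def)
  qed
  moreover have "G = orthant_face (supp x)"
  proof (intro equalityI subsetI)
    fix y assume "y \<in> G"
    then show "y \<in> orthant_face (supp x)"
      using supp_le[of y] by (auto simp: G_def orthant_face_def nonneg_orthant_def supp_def)
  next
    fix z assume z: "z \<in> orthant_face (supp x)"
    then have z0: "z \<in> nonneg_orthant" using orthant_face_subset by blast
    \<comment> \<open>The segment from \<open>z\<close> to \<open>x\<close> can be prolonged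
      slightly beyond \<open>x\<close> within the orthant, because \<open>z\<close> vanishes
      wherever \<open>x\<close> does. The image of \<open>x\<close> then lies strictly between those
      of \<open>z\<close> and \<open>?w\<close>, and the face property puts \<open>A *v z\<close>
      into \<open>F\<close>.\<close>
    obtain e where e: "0 < e" "x + e *\<^sub>R (x - z) \<in> nonneg_orthant"
      by (rule nonneg_orthant_perturbation[OF x0, of "x - z"])
        (use z in \<open>auto simp: supp_def orthant_face_def\<close>)
    let ?w = "x + e *\<^sub>R (x - z)"
    have Aw: "A *v ?w = A *v x + e *\<^sub>R (A *v x - A *v z)"
      by (simp add: matrix_vector_right_distrib matrix_vector_mult_scaleR matrix_vector_mult_diff_distrib)
    have "A *v z \<in> F"
    \<comment> \<open>An open segment with equal endpoints is empty, so coinciding images are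
      treated apart.\<close>
    proof (cases "A *v z = A *v x")
      case True then show ?thesis using AxF by simp
    next
      case False
      have "A *v x = (1 - 1/(1+e)) *\<^sub>R (A *v z) + (1/(1+e)) *\<^sub>R (A *v ?w)"
      proof -
        have "(1 + e) *\<^sub>R (A *v x) = e *\<^sub>R (A *v z) + A *v ?w"
          unfolding Aw by (simp add: algebra_simps)
        then have "(1/(1+e)) *\<^sub>R ((1 + e) *\<^sub>R (A *v x)) = (1/(1+e)) *\<^sub>R (e *\<^sub>R (A *v z) + A *v ?w)"
          by simp
        moreover have "1 - 1/(1+e) = e/(1+e)" using e(1) by (simp add: field_simps)
        ultimately show ?thesis using e(1) by (simp add: scaleR_add_right)
      qed
      moreover have "0 < 1/(1+e)" "1/(1+e) < 1" using e(1) by auto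
      moreover have "A *v z \<noteq> A *v ?w"
      proof
        assume "A *v z = A *v ?w"
        then have "(1 + e) *\<^sub>R (A *v x - A *v z) = 0"
          unfolding Aw by (simp add: algebra_simps)
        then show False using e(1) False by auto
      qed
      ultimately have "A *v x \<in> open_segment (A *v z) (A *v ?w)"
        unfolding in_segment by blast
      then show ?thesis
        using face_ofD[OF F, of "A *v x" "A *v z" "A *v ?w"] AxF z0 e(2) by blast
    qed
    then show "z \<in> G" using z0 by (simp add: G_def)
  qed
  ultimately show ?thesis using that FG by blast
qed

text \<open>If the unit vector at \<open>i \<in> J\<close> has the same image as some
  \<open>z\<close> in \<open>orthant_face K\<close>, then \<open>axis i 1 - z\<close> lies in the
  nullspace and is nonnegative off \<open>K\<close>. Survival of \<open>K\<close> forces it to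
  vanish there, so \<open>i \<in> K\<close>.\<close>

lemma inj_on_image_orthant_face:
  fixes A :: "real ^ 'N::finite ^ 'n::finite"
  shows "inj_on (\<lambda>J. (*v) A ` orthant_face J) {J. face_survives A J}"
proof (rule inj_onI, simp)
  have *: "J \<subseteq> K" if K: "face_survives A K" and eq: "(*v) A ` orthant_face J = (*v) A ` orthant_face K" for J K
  proof
    fix i assume "i \<in> J"
    then have "axis i 1 \<in> orthant_face J" by (auto simp: orthant_face_def axis_def)
    then obtain z where z: "z \<in> orthant_face K" "A *v axis i 1 = A *v z" using eq by blast
    then have "axis i 1 - z \<in> nullspace A"
      by (simp add: nullspace_def matrix_vector_mult_diff_distrib)
    moreover have "\<forall>l. l \<notin> K \<longrightarrow> 0 \<le> (axis i 1 - z) $ l"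
      using z(1) by (auto simp: orthant_face_def axis_def)
    ultimately have "\<forall>l. l \<notin> K \<longrightarrow> (axis i 1 - z) $ l = 0"
      using K unfolding face_survives_def by blast
    then show "i \<in> K" using z(1) by (auto simp: orthant_face_def axis_def)
  qed
  fix J K assume "face_survives A J" "face_survives A K"
    "(*v) A ` orthant_face J = (*v) A ` orthant_face K"
  then show "J = K" using *[of K J] *[of J K] by blast
qed

text \<open>The correspondence covers every matrix. The dimension remains a separate condition
  because \<open>A\<close> may lower the dimension of a surviving face.\<close>

lemma face_count_image_orthant:
  fixes A :: "real ^ 'N::finite ^ 'n::finite"
  shows "face_count k ((*v) A ` nonneg_orthant)
       = card {J. face_survives A J \<and> aff_dim ((*v) A ` orthant_face J) = int k}"
proof -
  have "{F. F face_of ((*v) A ` nonneg_orthant) \<and> aff_dim F = int k}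
      = (\<lambda>J. (*v) A ` orthant_face J) ` {J. face_survives A J \<and> aff_dim ((*v) A ` orthant_face J) = int k}"
  proof (intro equalityI subsetI)
    fix F assume "F \<in> {F. F face_of ((*v) A ` nonneg_orthant) \<and> aff_dim F = int k}"
    then have F: "F face_of ((*v) A ` nonneg_orthant)" "aff_dim F = int k" by auto
    \<comment> \<open>The empty set has affine dimension -1, which is never
      \<open>int k\<close>.\<close>
    then have "F \<noteq> {}" by auto
    then show "F \<in> (\<lambda>J. (*v) A ` orthant_face J) ` {J. face_survives A J \<and> aff_dim ((*v) A ` orthant_face J) = int k}"
      using face_of_image_orthant_cases[OF F(1)] F(2) by blast
  qed (auto intro: face_of_image_orthant_face)
  then show ?thesis
    unfolding face_count_def
    by (simp add: card_image inj_on_subset[OF inj_on_image_orthant_face[of A]] Collect_mono_iff)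
qed

section \<open>Dimensions of the faces, and the face count of the orthant itself\<close>

lemma span_orthant_face: "span (orthant_face J) = {x :: real ^ 'N::finite. \<forall>i. i \<notin> J \<longrightarrow> x $ i = 0}"
proof (rule span_unique)
  show "orthant_face J \<subseteq> {x :: real ^ 'N. \<forall>i. i \<notin> J \<longrightarrow> x $ i = 0}"
    by (auto simp: orthant_face_def)
  show "subspace {x :: real ^ 'N. \<forall>i. i \<notin> J \<longrightarrow> x $ i = 0}"
    by (auto simp: subspace_def)
  fix T :: "(real ^ 'N) set" assume T: "orthant_face J \<subseteq> T" "subspace T"
  show "{x :: real ^ 'N. \<forall>i. i \<notin> J \<longrightarrow> x $ i = 0} \<subseteq> T"
  proof
    fix x :: "real ^ 'N" assume "x \<in> {x. \<forall>i. i \<notin> J \<longrightarrow> x $ i = 0}"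
    \<comment> \<open>The positive and the negative part of \<open>x\<close> both lie in the orthant
      face.\<close>
    then have "(\<chi> i. max (x $ i) 0) \<in> T" "(\<chi> i. max (- x $ i) 0) \<in> T"
      using T(1) by (auto simp: orthant_face_def subset_iff)
    then have "(\<chi> i. max (x $ i) 0) - (\<chi> i. max (- x $ i) 0) \<in> T"
      by (rule subspace_diff[OF T(2)])
    moreover have "(\<chi> i. max (x $ i) 0) - (\<chi> i. max (- x $ i) 0) = x"
      by (auto simp: vec_eq_iff max_def)
    ultimately show "x \<in> T" by simp
  qed
qed

lemma dim_orthant_face: "dim (orthant_face J :: (real ^ 'N::finite) set) = card J"
proof -
  have "{x :: real ^ 'N. \<forall>i. i \<notin> J \<longrightarrow> x $ i = 0}
      = {x. \<forall>b\<in>Basis. b \<notin> (\<lambda>i. axis i 1) ` J \<longrightarrow> x \<bullet> b = 0}"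
    by (auto simp: Basis_vec_def inner_axis axis_eq_axis image_iff)
  moreover have "(\<lambda>i. axis i (1::real)) ` J \<subseteq> (Basis :: (real ^ 'N) set)"
    by (auto simp: Basis_vec_def)
  ultimately have "dim {x :: real ^ 'N. \<forall>i. i \<notin> J \<longrightarrow> x $ i = 0} = card ((\<lambda>i. axis i (1::real) :: real ^ 'N) ` J)"
    by (simp add: dim_substandard)
  also have "\<dots> = card J" by (intro card_image inj_onI) (simp add: axis_eq_axis)
  finally show ?thesis
    using dim_span[of "orthant_face J :: (real ^ 'N) set"] by (simp only: span_orthant_face)
qed

lemma aff_dim_image_orthant_face:
  fixes A :: "real ^ 'N::finite ^ 'n::finite"
  shows "aff_dim ((*v) A ` orthant_face J) = int (dim ((*v) A ` orthant_face J))"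
  using zero_in_orthant_face[of J]
  by (intro aff_dim_zero hull_inc image_eqI[of _ _ 0]) auto

text \<open>The hypothesis says that the nullspace meets the span of the face only in 0, so
  \<open>A\<close> is injective on that span.\<close>

lemma dim_image_orthant_face:
  fixes A :: "real ^ 'N::finite ^ 'n::finite"
  assumes "\<And>v. v \<in> nullspace A \<Longrightarrow> (\<And>i. i \<notin> J \<Longrightarrow> v $ i = 0) \<Longrightarrow> v = 0"
  shows "dim ((*v) A ` orthant_face J) = card J"
proof -
  have "inj_on ((*v) A) (span (orthant_face J))"
    unfolding span_orthant_face
  proof (rule inj_onI)
    fix x y assume "x \<in> {x. \<forall>i. i \<notin> J \<longrightarrow> x $ i = 0}" "y \<in> {x. \<forall>i. i \<notin> J \<longrightarrow> x $ i = 0}"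
      "A *v x = A *v y"
    then have "x - y = 0"
      by (intro assms) (auto simp: nullspace_def matrix_vector_mult_diff_distrib)
    then show "x = y" by simp
  qed
  then show ?thesis
    using dim_image_eq[OF matrix_vector_mul_linear, of A "orthant_face J"] dim_orthant_face[of J] by simp
qed

text \<open>The identity matrix has trivial nullspace, so every coordinate face survives with its
  full dimension.\<close>

lemma face_count_nonneg_orthant:
  "face_count k (nonneg_orthant :: (real ^ 'N::finite) set) = CARD('N) choose k"
proof -
  let ?A = "mat 1 :: real ^ 'N ^ 'N"
  have "nullspace ?A = {0}" by (auto simp: nullspace_def)
  then have "face_survives ?A J" "aff_dim ((*v) ?A ` orthant_face J) = int (card J)" for J
    using aff_dim_image_orthant_face[of ?A J] dim_image_orthant_face[of ?A J]
    by (auto simp: face_survives_def)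
  then have "face_count k ((*v) ?A ` nonneg_orthant) = card {J :: 'N set. card J = k}"
    unfolding face_count_image_orthant by simp
  also have "\<dots> = CARD('N) choose k"
    using n_subsets[of "UNIV :: 'N set" k] by simp
  finally show ?thesis by simp
qed

subsection \<open>Measurability of the face count\<close>

lemma continuous_on_matrix_vector_mult [continuous_intros]:
  fixes f :: "'a::topological_space \<Rightarrow> real ^ 'N::finite ^ 'n::finite"
  assumes "continuous_on S f" "continuous_on S g"
  shows "continuous_on S (\<lambda>x. f x *v g x)"
  unfolding matrix_vector_mult_def
  by (intro continuous_intros assms)

text \<open>Projecting a closed set of pairs along the compact factor \<open>K\<close> gives a
  closed set.\<close>

lemma closed_kernel_meets_compact:
  fixes K :: "(real ^ 'N::finite) set"
  assumes "compact K"
  shows "closed {A :: real ^ 'N ^ 'n::finite. \<exists>v\<in>K. A *v v = 0}"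
proof -
  have "closed {z :: (real ^ 'N) \<times> (real ^ 'N ^ 'n). snd z *v fst z = 0}"
    by (intro closed_Collect_eq continuous_intros)
  from closed_compact_projection[OF assms this] show ?thesis
    by (simp add: Bex_def)
qed

text \<open>The cone of witnesses against survival is not compact, so it is exhausted by compact slices
  normalised by the sum of the coordinates outside \<open>J\<close>.\<close>

lemma borel_face_survives [measurable]:
  "{A :: real ^ 'N::finite ^ 'n::finite. face_survives A J} \<in> sets borel"
proof -
  define K where "K = (\<lambda>r::nat. {v :: real ^ 'N. (\<forall>i. i \<notin> J \<longrightarrow> 0 \<le> v $ i) \<and> (\<Sum>i\<in>-J. v $ i) = 1 \<and> norm v \<le> real r})"
  have "closed {A :: real ^ 'N ^ 'n. \<exists>v\<in>K r. A *v v = 0}" for r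
  proof -
    have "K r = {v. \<forall>i. i \<notin> J \<longrightarrow> 0 \<le> v $ i} \<inter> {v. (\<Sum>i\<in>-J. v $ i) = 1} \<inter> cball 0 (real r)"
      by (auto simp: K_def)
    moreover have "closed {v :: real ^ 'N. \<forall>i. i \<notin> J \<longrightarrow> 0 \<le> v $ i}"
      by (intro closed_Collect_all closed_Collect_imp closed_Collect_le continuous_intros) auto
    moreover have "closed {v :: real ^ 'N. (\<Sum>i\<in>-J. v $ i) = 1}"
      by (intro closed_Collect_eq continuous_intros)
    ultimately have "compact (K r)" by (simp add: closed_Int closed_Int_compact)
    then show ?thesis by (rule closed_kernel_meets_compact)
  qed
  then have "(\<Union>r. {A :: real ^ 'N ^ 'n. \<exists>v\<in>K r. A *v v = 0}) \<in> sets borel"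
    by (intro sets.countable_UN) auto
  moreover have "\<not> face_survives A J \<longleftrightarrow> (\<exists>r. \<exists>v\<in>K r. A *v v = 0)" for A :: "real ^ 'N ^ 'n"
  proof
    assume "\<not> face_survives A J"
    then obtain v i where v: "A *v v = 0" "\<forall>i. i \<notin> J \<longrightarrow> 0 \<le> v $ i" "i \<notin> J" "v $ i \<noteq> 0"
      by (auto simp: face_survives_def nullspace_def)
    \<comment> \<open>\<open>s\<close> is positive because \<open>v\<close> is nonnegative off
      \<open>J\<close> and nonzero there. Entries in \<open>J\<close> are unrestricted, which is why
      a norm bound \<open>r\<close> accompanies the normalisation.\<close>
    define s where "s = (\<Sum>i\<in>-J. v $ i)"
    have "0 < s" unfolding s_def
      by (rule sum_pos2[of _ i]) (use v in \<open>auto simp: less_le\<close>)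
    then have "(\<Sum>i\<in>-J. ((1/s) *\<^sub>R v) $ i) = 1"
      by (simp add: s_def flip: sum_divide_distrib)
    moreover obtain r where "norm ((1/s) *\<^sub>R v) \<le> real r" using real_arch_simple by blast
    ultimately have "(1/s) *\<^sub>R v \<in> K r" using v(2) \<open>0 < s\<close> by (simp add: K_def)
    moreover have "A *v ((1/s) *\<^sub>R v) = 0" by (simp add: matrix_vector_mult_scaleR v(1))
    ultimately show "\<exists>r. \<exists>v\<in>K r. A *v v = 0" by blast
  next
    assume "\<exists>r. \<exists>v\<in>K r. A *v v = 0"
    then obtain v where v: "A *v v = 0" "\<forall>i. i \<notin> J \<longrightarrow> 0 \<le> v $ i" "(\<Sum>i\<in>-J. v $ i) = 1"
      by (auto simp: K_def)
    show "\<not> face_survives A J"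
    proof
      assume "face_survives A J"
      then have "\<forall>i. i \<notin> J \<longrightarrow> v $ i = 0"
        using v(1,2) unfolding face_survives_def nullspace_def by blast
      then have "(\<Sum>i\<in>-J. v $ i) = 0" by (intro sum.neutral) auto
      then show False using v by simp
    qed
  qed
  then have "{A :: real ^ 'N ^ 'n. face_survives A J} = - (\<Union>r. {A. \<exists>v\<in>K r. A *v v = 0})"
    by blast
  ultimately show ?thesis by (simp only: borel_comp)
qed

text \<open>Expresses a lower bound on a rank through injectivity on fixed subspaces, which is an
  open condition on the map. For the forward direction, \<open>d\<close> independent image vectors
  are lifted to a set \<open>C\<close>, and \<open>W\<close> is its span.\<close>

lemma dim_image_ge_iff:
  fixes f :: "'a::euclidean_space \<Rightarrow> 'b::euclidean_space"
  assumes "linear f"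
  shows "d \<le> dim (f ` S) \<longleftrightarrow>
    (\<exists>W. subspace W \<and> W \<subseteq> span S \<and> dim W = d \<and> (\<forall>v\<in>W. f v = 0 \<longrightarrow> v = 0))"
proof
  assume "d \<le> dim (f ` S)"
  moreover obtain B where B: "B \<subseteq> f ` S" "independent B" "card B = dim (f ` S)"
    using basis_exists[of "f ` S"] by metis
  ultimately obtain B' where B': "B' \<subseteq> B" "card B' = d"
    by (metis obtain_subset_with_card_n)
  then have "B' \<subseteq> f ` S" using B by blast
  then obtain C where C: "C \<subseteq> S" "inj_on f C" "B' = f ` C" unfolding subset_image_inj by blast
  have indep: "independent (f ` C)" using B(2) B'(1) C(3) independent_mono by blast
  \<comment> \<open>\<open>g\<close> sends each image vector back to its lift, so it is a linear
    left inverse of \<open>f\<close> on \<open>span C\<close>.\<close>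
  then obtain g where g: "linear g" "\<forall>b\<in>f ` C. g b = the_inv_into C f b"
    using linear_independent_extend by blast
  then have "(g \<circ> f) x = id x" if "x \<in> C" for x
    using that C(2) by (simp add: the_inv_into_f_f)
  then have gf: "(g \<circ> f) x = id x" if "x \<in> span C" for x
    using linear_eq_on_span[OF linear_compose[OF assms g(1)] linear_id, of C] that by blast
  then have "inj_on f (span C)"
    by (metis comp_apply id_apply inj_onI)
  then have "dim (span C) = dim (f ` C)"
    using dim_image_eq[OF assms] by (simp add: dim_span)
  also have "\<dots> = d" using dim_eq_card_independent[OF indep] C(3) B'(2) by simp
  finally have "dim (span C) = d" .
  moreover have "v = 0" if "v \<in> span C" "f v = 0" for v
    using gf[OF that(1)] that(2) linear_0[OF g(1)] by simp
  moreover have "span C \<subseteq> span S" using C(1) by (rule span_mono)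
  ultimately show "\<exists>W. subspace W \<and> W \<subseteq> span S \<and> dim W = d \<and> (\<forall>v\<in>W. f v = 0 \<longrightarrow> v = 0)"
    using subspace_span by blast
next
  assume "\<exists>W. subspace W \<and> W \<subseteq> span S \<and> dim W = d \<and> (\<forall>v\<in>W. f v = 0 \<longrightarrow> v = 0)"
  then obtain W where W: "subspace W" "W \<subseteq> span S" "dim W = d" "\<forall>v\<in>W. f v = 0 \<longrightarrow> v = 0" by blast
  have "inj_on f (span W)"
    using W(1,4) linear_injective_on_subspace_0[OF assms W(1)] by (simp add: span_eq_iff[THEN iffD2])
  then have "d = dim (f ` W)" using dim_image_eq[OF assms] W(3) by metis
  also have "\<dots> \<le> dim (f ` span S)" using W(2) by (intro dim_subset image_mono)
  also have "\<dots> = dim (f ` S)" using linear_span_image[OF assms, of S] by (metis dim_span)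
  finally show "d \<le> dim (f ` S)" .
qed

text \<open>Lower semicontinuity of the rank: \<open>A\<close> is injective on \<open>W\<close> iff
  its kernel misses the compact unit sphere of \<open>W\<close>. The union over \<open>W\<close> may
  be uncountable, so openness is used rather than mere measurability.\<close>

lemma open_dim_image_ge:
  fixes S :: "(real ^ 'N::finite) set"
  shows "open {A :: real ^ 'N ^ 'n::finite. d \<le> dim ((*v) A ` S)}"
proof -
  have "open {A :: real ^ 'N ^ 'n. \<forall>v\<in>W. A *v v = 0 \<longrightarrow> v = 0}" if W: "subspace W" for W
  proof -
    have "(\<forall>v\<in>W. A *v v = 0 \<longrightarrow> v = 0) \<longleftrightarrow> \<not> (\<exists>v\<in>W \<inter> sphere 0 1. A *v v = 0)" for A :: "real ^ 'N ^ 'n"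
    proof
      assume "\<not> (\<exists>v\<in>W \<inter> sphere 0 1. A *v v = 0)"
      moreover have "(1 / norm v) *\<^sub>R v \<in> W \<inter> sphere 0 1" "A *v ((1 / norm v) *\<^sub>R v) = 0"
        if "v \<in> W" "A *v v = 0" "v \<noteq> 0" for v
        using that W by (simp_all add: subspace_scale matrix_vector_mult_scaleR)
      ultimately show "\<forall>v\<in>W. A *v v = 0 \<longrightarrow> v = 0" by blast
    qed auto
    moreover have "compact (W \<inter> sphere 0 1)"
      using W by (intro closed_Int_compact closed_subspace) auto
    ultimately show ?thesis
      using closed_kernel_meets_compact[OF \<open>compact (W \<inter> sphere 0 1)\<close>]
      by (simp only: open_closed Collect_neg_eq double_complement)
  qed
  moreover have "{A :: real ^ 'N ^ 'n. d \<le> dim ((*v) A ` S)}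
    = (\<Union>W\<in>{W. subspace W \<and> W \<subseteq> span S \<and> dim W = d}. {A. \<forall>v\<in>W. A *v v = 0 \<longrightarrow> v = 0})"
    by (auto simp: dim_image_ge_iff[OF matrix_vector_mul_linear])
  ultimately show ?thesis by auto
qed

text \<open>The count is a finite sum of indicators over \<open>J\<close>, and each dimension
  condition is a difference of two open sets.\<close>

lemma borel_measurable_face_count_image_orthant [measurable]:
  "(\<lambda>A :: real ^ 'N::finite ^ 'n::finite. real (face_count k ((*v) A ` nonneg_orthant)))
     \<in> borel_measurable borel"
proof -
  have eq: "{A :: real ^ 'N ^ 'n. aff_dim ((*v) A ` orthant_face J) = int k}
     = {A. k \<le> dim ((*v) A ` orthant_face J)} - {A. Suc k \<le> dim ((*v) A ` orthant_face J)}" for J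
    by (auto simp: aff_dim_image_orthant_face)
  have [measurable]: "{A :: real ^ 'N ^ 'n. aff_dim ((*v) A ` orthant_face J) = int k} \<in> sets borel" for J
    unfolding eq by (intro sets.Diff borel_open open_dim_image_ge)
  have "real (face_count k ((*v) A ` nonneg_orthant))
     = (\<Sum>J\<in>UNIV. indicator ({A. face_survives A J} \<inter> {A. aff_dim ((*v) A ` orthant_face J) = int k}) A)"
    for A :: "real ^ 'N ^ 'n"
    unfolding face_count_image_orthant
    by (simp add: indicator_def sum.If_cases)
  then show ?thesis by simp
qed

subsection \<open>Random subspaces\<close>

text \<open>The columns of \<open>B\<close> act as linear functionals on \<open>y\<close>; this is
  how independence of columns becomes interpolation in the row space.\<close>

lemma vector_matrix_mult_nth:
  fixes B :: "real ^ 'N::finite ^ 'm::finite"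
  shows "(y v* B) $ i = column i B \<bullet> y"
  by (simp add: vector_matrix_mult_def column_def inner_vec_def mult.commute)

lemma row_space_eq_range:
  fixes B :: "real ^ 'N::finite ^ 'm::finite"
  shows "row_space B = range (\<lambda>y. y v* B)"
proof
  have "row i B = axis i 1 v* B" for i
    by (simp add: vec_eq_iff vector_matrix_mult_nth row_def column_def inner_axis)
  then have "rows B \<subseteq> range (\<lambda>y. y v* B)" by (auto simp: rows_def)
  moreover have "subspace (range (\<lambda>y. y v* B))"
    using linear_subspace_image[OF matrix_vector_mul_linear[of "transpose B"] subspace_UNIV] by simp
  ultimately show "row_space B \<subseteq> range (\<lambda>y. y v* B)"
    unfolding row_space_def by (rule span_minimal)
  show "range (\<lambda>y. y v* B) \<subseteq> row_space B"
    unfolding row_space_def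
    using matrix_vector_mult_in_columnspace[of "transpose B"] by (auto simp: columns_transpose)
qed

text \<open>Any \<open>CARD('m)\<close> columns form a basis of the coefficient space. Values
  prescribed on a basis extend to a linear functional, whose representing vector is the required
  \<open>y\<close>; conversely, a \<open>y\<close> orthogonal to a basis is 0.\<close>

lemma general_position_row_space:
  fixes B :: "real ^ 'N::finite ^ 'm::finite"
  assumes ind: "\<And>J. card J = CARD('m) \<Longrightarrow>
      inj_on (\<lambda>j. column j B) J \<and> independent ((\<lambda>j. column j B) ` J)"
    and le: "CARD('m) \<le> CARD('N)"
  shows "general_position CARD('m) UNIV (row_space B)"
proof (rule general_positionI)
  show "subspace (row_space B)" by (simp add: row_space_def)
next
  fix T :: "'N set" and c :: "'N \<Rightarrow> real"
  assume "card T \<le> CARD('m)"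
  then obtain J where J: "T \<subseteq> J" "card J = CARD('m)"
    using exists_subset_between[of T "CARD('m)" UNIV] le by auto
  obtain g :: "real ^ 'm \<Rightarrow> real" where "linear g"
    and g: "\<forall>b\<in>(\<lambda>j. column j B) ` J. g b = c (the_inv_into J (\<lambda>j. column j B) b)"
    using linear_independent_extend[OF conjunct2[OF ind[OF J(2)]],
        of "\<lambda>b. c (the_inv_into J (\<lambda>j. column j B) b)"] by auto
  \<comment> \<open>\<open>adjoint g 1\<close> is the vector that represents \<open>g\<close>
    through the inner product.\<close>
  have "column j B \<bullet> adjoint g 1 = c j" if "j \<in> J" for j
    using adjoint_works[OF \<open>linear g\<close>, of "column j B" 1] g that
      the_inv_into_f_f[OF conjunct1[OF ind[OF J(2)]] that]
    by simp
  then have "(adjoint g 1 v* B) $ i = c i" if "i \<in> T" for i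
    using J(1) that by (auto simp: vector_matrix_mult_nth)
  then show "\<exists>v\<in>row_space B. \<forall>i\<in>T. v $ i = c i"
    unfolding row_space_eq_range by blast
next
  fix T :: "'N set" and v :: "real ^ 'N"
  assume "CARD('m) \<le> card T" and v: "v \<in> row_space B" "\<And>i. i \<in> T \<Longrightarrow> v $ i = 0"
  then obtain J where J: "J \<subseteq> T" "card J = CARD('m)"
    by (metis obtain_subset_with_card_n)
  obtain y where y: "v = y v* B" using v(1) unfolding row_space_eq_range by blast
  have "card ((\<lambda>j. column j B) ` J) = DIM(real ^ 'm)"
    using ind[OF J(2)] J(2) by (simp add: card_image)
  then have "span ((\<lambda>j. column j B) ` J) = UNIV"
    using card_eq_dim[of "(\<lambda>j. column j B) ` J" UNIV] ind[OF J(2)] by auto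
  then have "y \<in> span ((\<lambda>j. column j B) ` J)" by simp
  moreover have "orthogonal y x" if "x \<in> (\<lambda>j. column j B) ` J" for x
    using that v(2) J(1) y by (auto simp: orthogonal_def vector_matrix_mult_nth inner_commute)
  ultimately have "orthogonal y y" by (metis orthogonal_to_span)
  then have "y = 0" by (simp add: orthogonal_self)
  then have "v $ i = 0" for i using y by (simp only: vector_matrix_mult_nth inner_zero_right)
  then show "v = 0" by (simp add: vec_eq_iff)
qed

text \<open>A nullspace vector supported on at most \<open>CARD('n)\<close> coordinates has at least
  \<open>m\<close> zeros and is therefore 0, so small faces keep their dimension. A weakly
  nonnegative witness against survival can be perturbed to a strictly positive one.\<close>

lemma survivors_general_position:
  fixes A :: "real ^ 'N::finite ^ 'n::finite"
  assumes gp: "general_position m UNIV (nullspace A)"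
    and m: "m = CARD('N) - CARD('n)" and k: "k < CARD('n)" and n: "CARD('n) < CARD('N)"
  shows "face_survives A J \<and> aff_dim ((*v) A ` orthant_face J) = int k
     \<longleftrightarrow> card J = k \<and> - J \<notin> sign_patterns (- J) (nullspace A)"
proof -
  have sub: "subspace (nullspace A)" by (rule general_position_subspace[OF gp])
  have compl: "card (- L) = CARD('N) - card L" for L :: "'N set"
    by (simp add: Compl_eq_Diff_UNIV card_Diff_subset)
  have dim: "dim ((*v) A ` orthant_face L) = card L" if "card L \<le> CARD('n)" for L
  proof (rule dim_image_orthant_face)
    fix v assume "v \<in> nullspace A" "\<And>i. i \<notin> L \<Longrightarrow> v $ i = 0"
    then show "v = 0"
      by (intro general_position_eq_0[OF gp, of "- L" v]) (use compl[of L] m that in auto)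
  qed
  have "card J = k" if "dim ((*v) A ` orthant_face J) = k"
  proof (cases "card J \<le> CARD('n)")
    case True then show ?thesis using dim that by simp
  next
    case False
    \<comment> \<open>A larger \<open>J\<close> contains a set \<open>L\<close> of size
      \<open>CARD('n)\<close>, whose image alone has dimension \<open>CARD('n) > k\<close>.\<close>
    then obtain L where L: "L \<subseteq> J" "card L = CARD('n)"
      by (metis obtain_subset_with_card_n nat_le_linear)
    then have "orthant_face L \<subseteq> orthant_face J" by (auto simp: orthant_face_def)
    then have "dim ((*v) A ` orthant_face L) \<le> dim ((*v) A ` orthant_face J)"
      by (intro dim_subset image_mono)
    then show ?thesis using dim[of L] L(2) that k by simp
  qed
  then have "aff_dim ((*v) A ` orthant_face J) = int k \<longleftrightarrow> card J = k"
    using dim[of J] k by (auto simp: aff_dim_image_orthant_face)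
  moreover have "face_survives A J \<longleftrightarrow> - J \<notin> sign_patterns (- J) (nullspace A)" if J: "card J = k"
  proof
    assume *: "face_survives A J"
    \<comment> \<open>Were \<open>- J\<close> empty, its empty pattern would be realised
      trivially.\<close>
    obtain i where "i \<notin> J" using J k n by (metis UNIV_eq_I less_irrefl less_trans)
    show "- J \<notin> sign_patterns (- J) (nullspace A)"
    proof
      assume "- J \<in> sign_patterns (- J) (nullspace A)"
      then obtain v where v: "v \<in> nullspace A" "\<forall>i\<in>- J. 0 < v $ i"
        unfolding sign_patterns_def by blast
      then have "\<forall>i. i \<notin> J \<longrightarrow> 0 \<le> v $ i" by (simp add: less_imp_le)
      then have "v $ i = 0"
        using * v(1) \<open>i \<notin> J\<close> unfolding face_survives_def by blast
      moreover have "0 < v $ i" using v(2) \<open>i \<notin> J\<close> by simp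
      ultimately show False by simp
    qed
  next
    assume *: "- J \<notin> sign_patterns (- J) (nullspace A)"
    show "face_survives A J"
    proof (rule ccontr)
      assume "\<not> face_survives A J"
      then obtain v i where v: "v \<in> nullspace A" "\<forall>i. i \<notin> J \<longrightarrow> 0 \<le> v $ i" "i \<notin> J" "v $ i \<noteq> 0"
        by (auto simp: face_survives_def)
      define Z where "Z = {i. i \<notin> J \<and> v $ i = 0}"
      \<comment> \<open>A nonzero nullspace vector cannot vanish on more than \<open>m\<close>
        coordinates, so values on \<open>Z\<close> can be prescribed; a small multiple of
        \<open>w\<close> then lifts these zeros to positive values.\<close>
      have "card Z \<le> m"
      proof (rule ccontr)
        assume "\<not> card Z \<le> m"
        then have "v = 0"
          by (intro general_position_eq_0[OF gp, of Z v]) (use v in \<open>auto simp: Z_def\<close>)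
        then show False using v(4) by simp
      qed
      then obtain w where w: "w \<in> nullspace A" "\<And>i. i \<in> Z \<Longrightarrow> w $ i = 1"
        by (rule general_position_interpolate[OF gp subset_UNIV, of Z "\<lambda>_. 1"]) blast
      obtain e where e: "0 < e" "\<And>i. i \<in> - J - Z \<Longrightarrow> 0 < v $ i + e * w $ i"
        by (rule small_perturbation[of "- J - Z" "\<lambda>i. v $ i" "\<lambda>i. w $ i"])
          (use v(2) in \<open>auto simp: Z_def less_le\<close>)
      have "0 < (v + e *\<^sub>R w) $ i" if "i \<in> - J" for i
      proof (cases "i \<in> Z")
        case True
        then show ?thesis using e(1) w(2) by (auto simp: Z_def)
      next
        case False
        then show ?thesis using e(2)[of i] that by simp
      qed
      moreover have "v + e *\<^sub>R w \<in> nullspace A"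
        using sub v(1) w(1) by (simp add: subspace_add subspace_scale)
      ultimately have "- J \<in> sign_patterns (- J) (nullspace A)"
        unfolding sign_patterns_def by blast
      then show False using * by blast
    qed
  qed
  ultimately show ?thesis by blast
qed

section \<open>Probabilities of sign patterns\<close>

lemma open_sign_pattern:
  "open {B :: real ^ 'N::finite ^ 'm::finite. P \<in> sign_patterns I (row_space B)}"
proof (cases "P \<subseteq> I")
  case True
  \<comment> \<open>For fixed \<open>y\<close> these are finitely many strict inequalities between
    continuous functions of \<open>B\<close>.\<close>
  have "open ((\<Inter>i\<in>P. {B :: real ^ 'N ^ 'm. 0 < (y v* B) $ i}) \<inter> (\<Inter>i\<in>I - P. {B. (y v* B) $ i < 0}))" for y
    unfolding vector_matrix_mult_def
    by (intro open_Int open_INT ballI open_Collect_less continuous_intros) auto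
  moreover have "{B :: real ^ 'N ^ 'm. P \<in> sign_patterns I (row_space B)}
    = (\<Union>y. (\<Inter>i\<in>P. {B. 0 < (y v* B) $ i}) \<inter> (\<Inter>i\<in>I - P. {B. (y v* B) $ i < 0}))"
    using True by (auto simp: sign_patterns_def row_space_eq_range)
  ultimately show ?thesis by auto
qed (simp add: sign_patterns_def)

text \<open>\<open>S\<close> flips the columns indexed by \<open>I - P\<close>, so the all-positive
  pattern for \<open>C ** S\<close> is the pattern \<open>P\<close> for \<open>C\<close>, and
  symmetry equates the probabilities.\<close>

lemma (in prob_space) prob_sign_pattern_eq:
  fixes B :: "'a \<Rightarrow> real ^ 'N::finite ^ 'm::finite"
  assumes "orthant_symmetric M B" and "P \<subseteq> I"
  shows "\<P>(\<omega> in M. P \<in> sign_patterns I (row_space (B \<omega>)))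
       = \<P>(\<omega> in M. I \<in> sign_patterns I (row_space (B \<omega>)))"
proof -
  define s where "s = (\<lambda>i. if i \<in> I - P then -1 else 1 :: real)"
  define S :: "real ^ 'N ^ 'N" where "S = (\<chi> i j. if i = j then s i else 0)"
  have "sign_matrix S" by (auto simp: sign_matrix_def S_def s_def)
  have nth: "(y v* (C ** S)) $ i = s i * (y v* C) $ i" for y and C :: "real ^ 'N ^ 'm" and i
  proof -
    have "y v* (C ** S) = (y v* C) v* S" by (simp add: vector_matrix_mul_assoc)
    moreover have "(u v* S) $ i = s i * u $ i" for u
      by (simp add: vector_matrix_mult_def S_def if_distrib cong: if_cong)
    ultimately show ?thesis by simp
  qed
  have "I \<in> sign_patterns I (row_space (C ** S)) \<longleftrightarrow> P \<in> sign_patterns I (row_space C)"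
    for C :: "real ^ 'N ^ 'm"
  proof -
    have "(\<forall>i\<in>I. 0 < (y v* (C ** S)) $ i) \<longleftrightarrow> (\<forall>i\<in>P. 0 < (y v* C) $ i) \<and> (\<forall>i\<in>I - P. (y v* C) $ i < 0)" for y
      using \<open>P \<subseteq> I\<close> unfolding nth s_def by auto
    then show ?thesis
      using \<open>P \<subseteq> I\<close> by (simp add: sign_patterns_def row_space_eq_range)
  qed
  moreover have "\<P>(\<omega> in M. B \<omega> ** S \<in> {C. I \<in> sign_patterns I (row_space C)})
      = \<P>(\<omega> in M. B \<omega> \<in> {C. I \<in> sign_patterns I (row_space C)})"
    using assms(1) \<open>sign_matrix S\<close> borel_open[OF open_sign_pattern]
    unfolding orthant_symmetric_def by blast
  ultimately show ?thesis by simp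
qed

text \<open>Double counting: the sum of \<open>2 ^ card I\<close> equal probabilities is the
  expected number of realised patterns, and that number is almost surely the constant from
  \<open>card_sign_patterns\<close>.\<close>

lemma (in prob_space) prob_all_positive:
  fixes B :: "'a \<Rightarrow> real ^ 'N::finite ^ 'm::finite"
  assumes "B \<in> borel_measurable M" "orthant_symmetric M B"
    and gp: "AE \<omega> in M. general_position m UNIV (row_space (B \<omega>))"
    and "I \<noteq> {}" "0 < m"
  shows "\<P>(\<omega> in M. I \<in> sign_patterns I (row_space (B \<omega>))) = wendel_P m (card I)"
proof -
  define E where "E = (\<lambda>P. {\<omega> \<in> space M. P \<in> sign_patterns I (row_space (B \<omega>))})"
  have E [measurable]: "E P \<in> events" for P
    using measurable_sets_Collect[OF assms(1), of "\<lambda>C. P \<in> sign_patterns I (row_space C)"]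
      borel_open[OF open_sign_pattern[where 'N='N and 'm='m]]
    by (simp add: E_def)
  define c where "c = (\<Sum>l<m. real ((card I - 1) choose l))"
  have "2 ^ card I * prob (E I) = (\<Sum>P\<in>Pow I. prob (E I))"
    by (simp add: card_Pow)
  also have "\<dots> = (\<Sum>P\<in>Pow I. prob (E P))"
    unfolding E_def by (intro sum.cong refl prob_sign_pattern_eq[OF assms(2), symmetric]) simp
  also have "\<dots> = (\<integral>\<omega>. (\<Sum>P\<in>Pow I. indicator (E P) \<omega>) \<partial>M)"
    by (subst Bochner_Integration.integral_sum) (simp_all add: emeasure_eq_measure)
  also have "\<dots> = (\<integral>\<omega>. 2 * c \<partial>M)"
  proof (rule integral_cong_AE)
    show "AE \<omega> in M. (\<Sum>P\<in>Pow I. indicator (E P) \<omega>) = 2 * c"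
      using gp AE_space
    proof eventually_elim
      case (elim \<omega>)
      have "(\<Sum>P\<in>Pow I. indicator (E P) \<omega>) = real (card (Pow I \<inter> {P. \<omega> \<in> E P}))"
        by (simp add: indicator_def sum.If_cases)
      also have "Pow I \<inter> {P. \<omega> \<in> E P} = sign_patterns I (row_space (B \<omega>))"
        using elim by (auto simp: E_def sign_patterns_def)
      also have "real (card \<dots>) = 2 * c"
        using card_sign_patterns[OF \<open>I \<noteq> {}\<close> general_position_mono[OF elim(1)]]
        by (simp add: c_def)
      finally show ?case .
    qed
  qed simp_all
  also have "\<dots> = 2 * c" by (simp add: prob_space)
  finally have *: "2 ^ card I * prob (E I) = 2 * c" .
  have "2 powi (1 - int (card I)) = 2 / (2::real) ^ card I"
    by (simp add: power_int_diff)
  \<comment> \<open>Since \<open>0 < m\<close>, the truncated bound \<open>m - 1\<close> gives the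
    same range as \<open>l < m\<close>.\<close>
  moreover have "(\<Sum>l = 0..m - 1. real ((card I - 1) choose l)) = c"
    unfolding c_def using \<open>0 < m\<close> by (intro sum.cong) auto
  ultimately have "wendel_P m (card I) = 2 * c / 2 ^ card I"
    by (simp add: wendel_P_def)
  also have "\<dots> = prob (E I)" using * by (simp add: field_simps)
  finally show ?thesis by (simp add: E_def)
qed

section \<open>From pattern probabilities to the expected face count\<close>

theorem theorem1p10:
  fixes M :: "'w measure"
    and A :: "'w \<Rightarrow> real ^ 'N ^ 'n"
    and B :: "'w \<Rightarrow> real ^ 'N ^ 'm"
    and k :: nat
  assumes "prob_space M"
    and "k < CARD('n)" and "CARD('n) < CARD('N)"
    and "A \<in> borel_measurable M"
    and "orthant_symmetric_generic_nullspace M A B"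
  shows "(\<integral>\<omega>. real (face_count k ((\<lambda>x. A \<omega> *v x) ` nonneg_orthant)) \<partial>M)
           / real (face_count k (nonneg_orthant :: (real ^ 'N) set))
         = 1 - wendel_P (CARD('N) - CARD('n)) (CARD('N) - k)"
proof -
  interpret prob_space M by fact
  define m where "m = CARD('N) - CARD('n)"
  have m: "CARD('m) = m" "0 < m" "m \<le> CARD('N)" and B [measurable]: "B \<in> borel_measurable M"
    and sym: "orthant_symmetric M B" and gen: "generic_columns M B"
    and null: "AE \<omega> in M. nullspace (A \<omega>) = row_space (B \<omega>)"
    using assms(3,5) by (auto simp: orthant_symmetric_generic_nullspace_def m_def)
  \<comment> \<open>There are only finitely many \<open>J\<close>, so the almost sure statements
    merge into one.\<close>
  have "AE \<omega> in M. \<forall>J :: 'N set\<in>{J. card J = CARD('m)}.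
      inj_on (\<lambda>j. column j (B \<omega>)) J \<and> independent ((\<lambda>j. column j (B \<omega>)) ` J)"
    using gen by (intro AE_finite_allI) (auto simp: generic_columns_def)
  then have gp: "AE \<omega> in M. general_position m UNIV (row_space (B \<omega>))"
  proof eventually_elim
    case (elim \<omega>)
    then show ?case using general_position_row_space[of "B \<omega>"] m by simp
  qed
  define \<J> where "\<J> = {J :: 'N set. card J = k}"
  \<comment> \<open>For \<open>J \<in> \<J>\<close> this is, up to a null set, the event that the
    face indexed by \<open>J\<close> is lost.\<close>
  define E where "E = (\<lambda>J. {\<omega> \<in> space M. - J \<in> sign_patterns (- J) (row_space (B \<omega>))})"
  have E [measurable]: "E J \<in> events" for J
    using measurable_sets_Collect[OF B, of "\<lambda>C. - J \<in> sign_patterns (- J) (row_space C)"]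
      borel_open[OF open_sign_pattern[where 'N='N and 'm='m]]
    by (simp add: E_def)
  have prob_E: "prob (E J) = wendel_P m (CARD('N) - k)" if "J \<in> \<J>" for J
  proof -
    have "card (- J) = CARD('N) - k" using that by (simp add: \<J>_def Compl_eq_Diff_UNIV card_Diff_subset)
    moreover from this have "- J \<noteq> {}" using assms(2,3) by (intro notI) simp
    ultimately show ?thesis
      using prob_all_positive[OF B sym gp _ m(2), of "- J"] by (simp add: E_def)
  qed
  have card_\<J>: "card \<J> = CARD('N) choose k"
    unfolding \<J>_def using n_subsets[of "UNIV :: 'N set" k] by simp
  have "(\<integral>\<omega>. real (face_count k ((\<lambda>x. A \<omega> *v x) ` nonneg_orthant)) \<partial>M)
      = (\<integral>\<omega>. (\<Sum>J\<in>\<J>. 1 - indicator (E J) \<omega>) \<partial>M)"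
  proof (rule integral_cong_AE)
    \<comment> \<open>The almost sure replacement needs a measurable integrand, and on the
      exceptional null set \<open>A\<close> may be any matrix.\<close>
    show "(\<lambda>\<omega>. real (face_count k ((*v) (A \<omega>) ` nonneg_orthant))) \<in> borel_measurable M"
      by (rule measurable_compose[OF assms(4) borel_measurable_face_count_image_orthant])
    show "AE \<omega> in M. real (face_count k ((*v) (A \<omega>) ` nonneg_orthant)) = (\<Sum>J\<in>\<J>. 1 - indicator (E J) \<omega>)"
      using gp null AE_space
    proof eventually_elim
      case (elim \<omega>)
      then have "general_position m UNIV (nullspace (A \<omega>))" by simp
      note survivors_general_position[OF this m_def assms(2,3)]
      then have "real (face_count k ((*v) (A \<omega>) ` nonneg_orthant)) = real (card (\<J> \<inter> {J. \<omega> \<notin> E J}))"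
        unfolding face_count_image_orthant \<J>_def E_def using elim
        by (simp add: Collect_conj_eq)
      also have "\<dots> = (\<Sum>J\<in>\<J>. if \<omega> \<notin> E J then 1 else 0)"
        by (simp add: sum.If_cases)
      also have "\<dots> = (\<Sum>J\<in>\<J>. 1 - indicator (E J) \<omega>)"
        by (intro sum.cong) auto
      finally show ?case .
    qed
  qed simp
  also have "\<dots> = (\<Sum>J\<in>\<J>. 1 - prob (E J))"
    by (subst Bochner_Integration.integral_sum) (simp_all add: emeasure_eq_measure prob_space)
  also have "\<dots> = real (CARD('N) choose k) * (1 - wendel_P m (CARD('N) - k))"
    using prob_E by (simp add: card_\<J>)
  \<comment> \<open>Since \<open>k < CARD('N)\<close>, the binomial coefficient is nonzero and
    cancels.\<close>
  finally show ?thesis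
    unfolding face_count_nonneg_orthant m_def using assms(2,3) by simp
qed

end
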